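(* Let $G$ be a finite non-abelian group containing a subgroup that is a 2-group of nilpotency class 2. Then the automata group $\mathcal G(\mathcal C(G))$ generated by the Cayley machine of $G$ does not embed in a wreath product $F\wr T$ of a finite group $F$ with a torsion-free group $T$.
   Context: Cayley machine: for a non-trivial finite group $G$, the Cayley machine $\mathcal C(G)$ is the automaton with state set $G$ and alphabet $G$ which, in state $g_0$ on reading input letter $g$, moves to state $g_0g$ and outputs $g_0g$. Each state $g\in G$ defines a bijection $\mathcal C(G)_g$ of the set $G^\omega$ of right-infinite words over $G$, namely $\mathcal C(G)_g(a_0,a_1,a_2,\ldots)=(ga_0,\,ga_0a_1,\,ga_0a_1a_2,\ldots)$. The automata group $\mathcal G(\mathcal C(G))$ is the group of bijections of $G^\omega$ generated by all $\mathcal C(G)_g$, $g\in G$, with product given by composition. Wreath products are restricted: $F\wr T=\left(\bigoplus_{T}F\right)\rtimes T$, with $T$ acting by shifting coordinates. *)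

theory Defs
  imports "HOL-Algebra.Algebra"
begin

section \<open>Mealy automata and automata groups\<close>

record ('q, 'x) mealy =
  states :: "'q set"
  alphabet :: "'x set"
  next_state :: "'q \<Rightarrow> 'x \<Rightarrow> 'q"
  out_letter :: "'q \<Rightarrow> 'x \<Rightarrow> 'x"

definition omega_words :: "'x set \<Rightarrow> (nat \<Rightarrow> 'x) set" where
  "omega_words A = {a. \<forall>n. a n \<in> A}"

primrec state_at :: "('q, 'x) mealy \<Rightarrow> 'q \<Rightarrow> (nat \<Rightarrow> 'x) \<Rightarrow> nat \<Rightarrow> 'q" where
  "state_at M q a 0 = q"
| "state_at M q a (Suc n) = next_state M (state_at M q a n) (a n)"

definition mealy_map :: "('q, 'x) mealy \<Rightarrow> 'q \<Rightarrow> (nat \<Rightarrow> 'x) \<Rightarrow> (nat \<Rightarrow> 'x)" where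
  "mealy_map M q = (\<lambda>a \<in> omega_words (alphabet M). \<lambda>n. out_letter M (state_at M q a n) (a n))"

text \<open>\<^const>\<open>subgroup_generated\<close> discards generators outside the carrier, so this is meant only for
  machines all of whose state maps are bijections of the set of right-infinite words; lemma
  \<open>cayley_map_Bij\<close> below shows that Cayley machines are of this kind.\<close>

definition automata_group :: "('q, 'x) mealy \<Rightarrow> ((nat \<Rightarrow> 'x) \<Rightarrow> (nat \<Rightarrow> 'x)) monoid" where
  "automata_group M =
     subgroup_generated (BijGroup (omega_words (alphabet M))) (mealy_map M ` states M)"

definition cayley_machine :: "('a, 'm) monoid_scheme \<Rightarrow> ('a, 'a) mealy" where
  "cayley_machine G =
     \<lparr>states = carrier G, alphabet = carrier G, next_state = (\<otimes>\<^bsub>G\<^esub>), out_letter = (\<otimes>\<^bsub>G\<^esub>)\<rparr>"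

lemma state_at_cayley:
  "state_at (cayley_machine G) g a n = foldl (\<otimes>\<^bsub>G\<^esub>) g (map a [0..<n])"
  by (induction n) (simp_all add: cayley_machine_def)

lemma cayley_map_apply:
  assumes "a \<in> omega_words (carrier G)"
  shows "mealy_map (cayley_machine G) g a n = foldl (\<otimes>\<^bsub>G\<^esub>) g (map a [0..<Suc n])"
  using assms state_at_cayley[of G g a n]
  by (simp add: mealy_map_def) (simp add: cayley_machine_def)

lemma (in group) cayley_map_Bij:
  assumes g: "g \<in> carrier G"
  shows "mealy_map (cayley_machine G) g \<in> carrier (BijGroup (omega_words (carrier G)))"
proof -
  let ?W = "omega_words (carrier G)" and ?f = "mealy_map (cayley_machine G) g"
  have f0: "?f a 0 = g \<otimes> a 0" if "a \<in> ?W" for a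
    using that by (simp add: cayley_map_apply)
  have fS: "?f a (Suc n) = ?f a n \<otimes> a (Suc n)" if "a \<in> ?W" for a n
    using that by (simp add: cayley_map_apply)
  have aC: "a n \<in> carrier G" if "a \<in> ?W" for a n
    using that by (auto simp: omega_words_def)
  have fC: "?f a n \<in> carrier G" if "a \<in> ?W" for a n
    by (induction n) (simp_all add: f0 fS that g aC)
  have inj: "inj_on ?f ?W"
  proof (rule inj_onI)
    fix a b assume a: "a \<in> ?W" and b: "b \<in> ?W" and eq: "?f a = ?f b"
    have "a n = b n" for n
    proof (cases n)
      case 0
      have "g \<otimes> a 0 = g \<otimes> b 0" using f0[OF a] f0[OF b] eq by simp
      then show ?thesis using g aC[OF a] aC[OF b] 0 by simp
    next
      case (Suc m)
      have "?f a m \<otimes> a (Suc m) = ?f a m \<otimes> b (Suc m)"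
        using fS[OF a] fS[OF b] eq by metis
      then show ?thesis using fC[OF a] aC[OF a] aC[OF b] Suc by simp
    qed
    then show "a = b" by auto
  qed
  have surj: "b \<in> ?f ` ?W" if b: "b \<in> ?W" for b
  proof -
    define a where
      "a n = (case n of 0 \<Rightarrow> inv g \<otimes> b 0 | Suc m \<Rightarrow> inv (b m) \<otimes> b (Suc m))" for n
    have a: "a \<in> ?W"
      using g aC[OF b] by (auto simp: a_def omega_words_def split: nat.splits)
    have a0: "a 0 = inv g \<otimes> b 0" and aS: "a (Suc n) = inv (b n) \<otimes> b (Suc n)" for n
      by (simp_all add: a_def)
    have "?f a n = b n" for n
    proof (induction n)
      case 0
      show ?case unfolding f0[OF a] a0 using g aC[OF b] by (simp add: m_assoc[symmetric])
    next
      case (Suc n)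
      show ?case unfolding fS[OF a] aS Suc.IH using aC[OF b] by (simp add: m_assoc[symmetric])
    qed
    then have "b = ?f a" by auto
    then show ?thesis using a by blast
  qed
  have "?f ` ?W \<subseteq> ?W" using fC by (auto simp: omega_words_def)
  then have "bij_betw ?f ?W ?W" using inj surj by (auto simp: bij_betw_def)
  moreover have "?f \<in> extensional ?W"
    by (simp add: mealy_map_def cayley_machine_def)
  ultimately show ?thesis by (simp add: BijGroup_def Bij_def)
qed

section \<open>Nilpotency class and \<open>p\<close>-groups\<close>

definition commutator :: "('a, 'm) monoid_scheme \<Rightarrow> 'a \<Rightarrow> 'a \<Rightarrow> 'a" where
  "commutator G x y = x \<otimes>\<^bsub>G\<^esub> y \<otimes>\<^bsub>G\<^esub> inv\<^bsub>G\<^esub> x \<otimes>\<^bsub>G\<^esub> inv\<^bsub>G\<^esub> y"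

text \<open>Indexing starts at 0, so \<open>lower_central G n\<close> is the term usually written
  \<open>\<gamma>\<close> with index \<open>n + 1\<close>.\<close>

primrec lower_central :: "('a, 'm) monoid_scheme \<Rightarrow> nat \<Rightarrow> 'a set" where
  "lower_central G 0 = carrier G"
| "lower_central G (Suc n) =
     generate G {commutator G x y | x y. x \<in> lower_central G n \<and> y \<in> carrier G}"

definition has_nilpotency_class :: "('a, 'm) monoid_scheme \<Rightarrow> nat \<Rightarrow> bool" where
  "has_nilpotency_class G c \<longleftrightarrow>
     lower_central G c = {\<one>\<^bsub>G\<^esub>} \<and> (\<forall>n<c. lower_central G n \<noteq> {\<one>\<^bsub>G\<^esub>})"

definition finite_p_group :: "nat \<Rightarrow> ('a, 'm) monoid_scheme \<Rightarrow> bool" where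
  "finite_p_group p G \<longleftrightarrow> group G \<and> finite (carrier G) \<and> (\<exists>k. order G = p ^ k)"

definition torsion_free :: "('a, 'm) monoid_scheme \<Rightarrow> bool" where
  "torsion_free G \<longleftrightarrow>
     (\<forall>x \<in> carrier G. \<forall>n::nat. n > 0 \<longrightarrow> x [^]\<^bsub>G\<^esub> n = \<one>\<^bsub>G\<^esub> \<longrightarrow> x = \<one>\<^bsub>G\<^esub>)"

section \<open>Restricted wreath products\<close>

definition semidirect_product ::
    "('n, 'k) monoid_scheme \<Rightarrow> ('h, 'l) monoid_scheme \<Rightarrow> ('h \<Rightarrow> 'n \<Rightarrow> 'n) \<Rightarrow> ('n \<times> 'h) monoid" where
  "semidirect_product N H \<phi> =
     \<lparr>carrier = carrier N \<times> carrier H,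
      monoid.mult = (\<lambda>(m, h) (n, k). (m \<otimes>\<^bsub>N\<^esub> \<phi> h n, h \<otimes>\<^bsub>H\<^esub> k)),
      one = (\<one>\<^bsub>N\<^esub>, \<one>\<^bsub>H\<^esub>)\<rparr>"

definition shift :: "('t, 'l) monoid_scheme \<Rightarrow> 't \<Rightarrow> ('t \<Rightarrow> 'f) \<Rightarrow> ('t \<Rightarrow> 'f)" where
  "shift T t f = (\<lambda>x \<in> carrier T. f (inv\<^bsub>T\<^esub> t \<otimes>\<^bsub>T\<^esub> x))"

definition wreath_product ::
    "('f, 'k) monoid_scheme \<Rightarrow> ('t, 'l) monoid_scheme \<Rightarrow> (('t \<Rightarrow> 'f) \<times> 't) monoid" where
  "wreath_product F T = semidirect_product (sum_group (carrier T) (\<lambda>_. F)) T (shift T)"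

lemma group_semidirect_product:
  assumes N: "group N" and H: "group H"
    and hom: "\<And>h. h \<in> carrier H \<Longrightarrow> \<phi> h \<in> hom N N"
    and one: "\<And>n. n \<in> carrier N \<Longrightarrow> \<phi> \<one>\<^bsub>H\<^esub> n = n"
    and mult: "\<And>h k n. \<lbrakk>h \<in> carrier H; k \<in> carrier H; n \<in> carrier N\<rbrakk>
                 \<Longrightarrow> \<phi> (h \<otimes>\<^bsub>H\<^esub> k) n = \<phi> h (\<phi> k n)"
  shows "group (semidirect_product N H \<phi>)"
proof -
  interpret N: group N by fact
  interpret H: group H by fact
  have cl [simp]: "\<phi> h n \<in> carrier N" if "h \<in> carrier H" "n \<in> carrier N" for h n
    using hom that by (auto simp: hom_def)
  have hm: "\<phi> h (m \<otimes>\<^bsub>N\<^esub> n) = \<phi> h m \<otimes>\<^bsub>N\<^esub> \<phi> h n"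
    if "h \<in> carrier H" "m \<in> carrier N" "n \<in> carrier N" for h m n
    using hom that by (auto simp: hom_def)
  show ?thesis
  proof (rule groupI)
    fix x assume x: "x \<in> carrier (semidirect_product N H \<phi>)"
    then obtain n h where [simp]: "x = (n, h)" and nh: "n \<in> carrier N" "h \<in> carrier H"
      by (auto simp: semidirect_product_def)
    let ?y = "(\<phi> (inv\<^bsub>H\<^esub> h) (inv\<^bsub>N\<^esub> n), inv\<^bsub>H\<^esub> h)"
    have "\<phi> (inv\<^bsub>H\<^esub> h) \<one>\<^bsub>N\<^esub> = \<one>\<^bsub>N\<^esub>"
      using hom_one[OF hom[of "inv\<^bsub>H\<^esub> h"] N N] nh by simp
    then show "\<exists>y\<in>carrier (semidirect_product N H \<phi>).
        y \<otimes>\<^bsub>semidirect_product N H \<phi>\<^esub> x = \<one>\<^bsub>semidirect_product N H \<phi>\<^esub>"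
      using nh by (intro bexI[of _ ?y]) (auto simp: semidirect_product_def hm[symmetric])
  next
    fix x y z assume "x \<in> carrier (semidirect_product N H \<phi>)"
      "y \<in> carrier (semidirect_product N H \<phi>)" "z \<in> carrier (semidirect_product N H \<phi>)"
    then show "x \<otimes>\<^bsub>semidirect_product N H \<phi>\<^esub> y \<otimes>\<^bsub>semidirect_product N H \<phi>\<^esub> z =
        x \<otimes>\<^bsub>semidirect_product N H \<phi>\<^esub> (y \<otimes>\<^bsub>semidirect_product N H \<phi>\<^esub> z)"
      by (auto simp: semidirect_product_def mult hm N.m_assoc H.m_assoc)
  qed (auto simp: semidirect_product_def one)
qed

lemma group_wreath_product:
  assumes F: "group F" and T: "group T"
  shows "group (wreath_product F T)"
  unfolding wreath_product_def
proof (rule group_semidirect_product)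
  interpret F: group F by fact
  interpret T: group T by fact
  let ?S = "sum_group (carrier T) (\<lambda>_. F)"
  have S: "carrier ?S = {f \<in> carrier T \<rightarrow>\<^sub>E carrier F. finite {x \<in> carrier T. f x \<noteq> \<one>\<^bsub>F\<^esub>}}"
    by (simp add: carrier_sum_group F)
  show "group ?S" by (simp add: F)
  show "group T" by fact
  fix t assume t: "t \<in> carrier T"
  have cl: "shift T t f \<in> carrier ?S" if f: "f \<in> carrier ?S" for f
  proof -
    have "{x \<in> carrier T. shift T t f x \<noteq> \<one>\<^bsub>F\<^esub>}
        \<subseteq> (\<lambda>x. t \<otimes>\<^bsub>T\<^esub> x) ` {x \<in> carrier T. f x \<noteq> \<one>\<^bsub>F\<^esub>}"
    proof
      fix x assume "x \<in> {x \<in> carrier T. shift T t f x \<noteq> \<one>\<^bsub>F\<^esub>}"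
      then have "x = t \<otimes>\<^bsub>T\<^esub> (inv\<^bsub>T\<^esub> t \<otimes>\<^bsub>T\<^esub> x)"
          "inv\<^bsub>T\<^esub> t \<otimes>\<^bsub>T\<^esub> x \<in> {x \<in> carrier T. f x \<noteq> \<one>\<^bsub>F\<^esub>}"
        using t by (auto simp: shift_def T.m_assoc[symmetric])
      then show "x \<in> (\<lambda>x. t \<otimes>\<^bsub>T\<^esub> x) ` {x \<in> carrier T. f x \<noteq> \<one>\<^bsub>F\<^esub>}" by blast
    qed
    then have "finite {x \<in> carrier T. shift T t f x \<noteq> \<one>\<^bsub>F\<^esub>}"
      using f by (auto simp: S intro: finite_subset)
    then show ?thesis using f t by (auto simp: S shift_def PiE_iff)
  qed
  show "shift T t \<in> hom ?S ?S"
  proof (rule homI)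
    fix f g
    show "shift T t (f \<otimes>\<^bsub>?S\<^esub> g) = shift T t f \<otimes>\<^bsub>?S\<^esub> shift T t g"
      unfolding mult_sum_group shift_def using t by (intro restrict_ext) simp
  qed (rule cl)
next
  fix f assume "f \<in> carrier (sum_group (carrier T) (\<lambda>_. F))"
  then have "f \<in> extensional (carrier T)"
    by (auto simp: carrier_sum_group F PiE_iff)
  moreover interpret T: group T by fact
  have "shift T \<one>\<^bsub>T\<^esub> f x = restrict f (carrier T) x" for x
    by (simp add: shift_def restrict_def)
  ultimately show "shift T \<one>\<^bsub>T\<^esub> f = f"
    by (simp add: fun_eq_iff extensional_restrict)
next
  interpret T: group T by fact
  fix s t f assume "s \<in> carrier T" "t \<in> carrier T"
  then show "shift T (s \<otimes>\<^bsub>T\<^esub> t) f = shift T s (shift T t f)"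
    by (auto simp: shift_def fun_eq_iff T.inv_mult_group T.m_assoc)
qed

definition embeds_in :: "('a, 'm) monoid_scheme \<Rightarrow> ('b, 'n) monoid_scheme \<Rightarrow> bool" where
  "embeds_in G H \<longleftrightarrow> (\<exists>h. h \<in> mon G H)"

end

(*
  Let t be the state map of the identity of G. Every state map factors as L_g t, where L_g is
  left multiplication by g in all coordinates, so the automata group contains a copy of G, and t,
  which has infinite order: its inverse moves the last non-trivial letter of a word one step to the
  right. As t fixes the first letter of every word, conjugates of L_g by powers of t never commute
  with L_h unless g and h commute. In a wreath product of a finite group with a torsion-free group,
  however, the image of G lies in the base group, t maps to an element that shifts the base group
  by an element of infinite order, and a sufficiently high power of it makes the supports of two
  elements of the base group disjoint, so that these commute.
*)

theory Submission
  imports Defs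
begin

section \<open>Wreath products\<close>

lemma carrier_wreath_product:
  assumes "group F"
  shows "carrier (wreath_product F T) =
    {f \<in> carrier T \<rightarrow>\<^sub>E carrier F. finite {x \<in> carrier T. f x \<noteq> \<one>\<^bsub>F\<^esub>}} \<times> carrier T"
  using assms by (simp add: wreath_product_def semidirect_product_def carrier_sum_group)

lemma mult_wreath_product:
  "(f, s) \<otimes>\<^bsub>wreath_product F T\<^esub> (g, t) =
    (\<lambda>x\<in>carrier T. f x \<otimes>\<^bsub>F\<^esub> g (inv\<^bsub>T\<^esub> s \<otimes>\<^bsub>T\<^esub> x), s \<otimes>\<^bsub>T\<^esub> t)"
  by (auto simp: wreath_product_def semidirect_product_def shift_def mult_sum_group fun_eq_iff)

lemma one_wreath_product:
  "\<one>\<^bsub>wreath_product F T\<^esub> = (\<lambda>x\<in>carrier T. \<one>\<^bsub>F\<^esub>, \<one>\<^bsub>T\<^esub>)"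
  by (simp add: wreath_product_def semidirect_product_def sum_group_def)

lemma snd_hom_wreath_product:
  assumes "group F"
  shows "snd \<in> hom (wreath_product F T) T"
  by (rule homI) (auto simp: carrier_wreath_product[OF assms] mult_wreath_product)

lemma pow_wreath_product_base:
  assumes "group F" "group T" "(f, \<one>\<^bsub>T\<^esub>) \<in> carrier (wreath_product F T)"
  shows "(f, \<one>\<^bsub>T\<^esub>) [^]\<^bsub>wreath_product F T\<^esub> (n::nat) = (\<lambda>x\<in>carrier T. f x [^]\<^bsub>F\<^esub> n, \<one>\<^bsub>T\<^esub>)"
proof -
  interpret F: group F by fact
  interpret T: group T by fact
  show ?thesis
    by (induction n) (auto simp: one_wreath_product mult_wreath_product fun_eq_iff)
qed

text \<open>No inverse has to be computed: writing the conjugate as \<open>(q, r)\<close> and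
  multiplying by \<open>(p, s)\<close> on the right gives
  \<open>(q, r) (p, s) = (p, s) (f, 1)\<close>. The second components force \<open>r\<close> to be
  trivial, and the first give \<open>q z * p z = p z * f (inv s * z)\<close>. Hence the support of
  \<open>q\<close> lies in the translate by \<open>s\<close> of the support of
  \<open>f\<close>.\<close>

lemma wreath_product_conj_base_support:
  assumes F: "group F" and T: "group T"
    and x: "(f, \<one>\<^bsub>T\<^esub>) \<in> carrier (wreath_product F T)"
    and u: "(p, s) \<in> carrier (wreath_product F T)"
  obtains q where
    "(p, s) \<otimes>\<^bsub>wreath_product F T\<^esub> (f, \<one>\<^bsub>T\<^esub>) \<otimes>\<^bsub>wreath_product F T\<^esub> inv\<^bsub>wreath_product F T\<^esub> (p, s) = (q, \<one>\<^bsub>T\<^esub>)"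
    "\<And>z. z \<in> carrier T \<Longrightarrow> f (inv\<^bsub>T\<^esub> s \<otimes>\<^bsub>T\<^esub> z) = \<one>\<^bsub>F\<^esub> \<Longrightarrow> q z = \<one>\<^bsub>F\<^esub>"
proof -
  interpret F: group F by fact
  interpret T: group T by fact
  let ?W = "wreath_product F T"
  interpret W: group ?W using F T by (rule group_wreath_product)
  obtain q r where qr: "(p, s) \<otimes>\<^bsub>?W\<^esub> (f, \<one>\<^bsub>T\<^esub>) \<otimes>\<^bsub>?W\<^esub> inv\<^bsub>?W\<^esub> (p, s) = (q, r)"
    by (meson surj_pair)
  have c: "(q, r) \<in> carrier ?W"
    unfolding qr[symmetric] using x u by simp
  have s: "s \<in> carrier T" and r: "r \<in> carrier T"
    using u c by (auto simp: carrier_wreath_product[OF F])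
  have pF: "p z \<in> carrier F" and qF: "q z \<in> carrier F" if "z \<in> carrier T" for z
    using u c that by (auto simp: carrier_wreath_product[OF F])
  have eq: "(q, r) \<otimes>\<^bsub>?W\<^esub> (p, s) = (p, s) \<otimes>\<^bsub>?W\<^esub> (f, \<one>\<^bsub>T\<^esub>)"
    unfolding qr[symmetric] using x u by (simp add: W.m_assoc)
  then have "r \<otimes>\<^bsub>T\<^esub> s = s"
    using s by (simp add: mult_wreath_product)
  then have r1: "r = \<one>\<^bsub>T\<^esub>"
    using s r by simp
  show ?thesis
  proof (rule that)
    show "(p, s) \<otimes>\<^bsub>?W\<^esub> (f, \<one>\<^bsub>T\<^esub>) \<otimes>\<^bsub>?W\<^esub> inv\<^bsub>?W\<^esub> (p, s) = (q, \<one>\<^bsub>T\<^esub>)"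
      using qr r1 by simp
  next
    fix z assume z: "z \<in> carrier T" "f (inv\<^bsub>T\<^esub> s \<otimes>\<^bsub>T\<^esub> z) = \<one>\<^bsub>F\<^esub>"
    have "q z \<otimes>\<^bsub>F\<^esub> p z = p z \<otimes>\<^bsub>F\<^esub> f (inv\<^bsub>T\<^esub> s \<otimes>\<^bsub>T\<^esub> z)"
      using eq z by (auto simp: mult_wreath_product r1 dest: fun_cong[of _ _ z])
    then show "q z = \<one>\<^bsub>F\<^esub>"
      using z pF qF by simp
  qed
qed

text \<open>This supplies infinitely many distinct shifts among the powers of \<open>s\<close>, so
  that a finite set of unsuitable ones can be avoided.\<close>

lemma torsion_free_inj_pow:
  assumes "group T" "torsion_free T" "s \<in> carrier T" "s \<noteq> \<one>\<^bsub>T\<^esub>"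
  shows "inj (\<lambda>n::nat. s [^]\<^bsub>T\<^esub> n)"
proof -
  interpret T: group T by fact
  have "m = n" if "m \<le> n" "s [^]\<^bsub>T\<^esub> m = s [^]\<^bsub>T\<^esub> n" for m n :: nat
  proof (rule ccontr)
    assume "m \<noteq> n"
    have "s [^]\<^bsub>T\<^esub> m \<otimes>\<^bsub>T\<^esub> s [^]\<^bsub>T\<^esub> (n - m) = s [^]\<^bsub>T\<^esub> n"
      using that(1) assms(3) by (simp add: T.nat_pow_mult)
    then have "s [^]\<^bsub>T\<^esub> m \<otimes>\<^bsub>T\<^esub> s [^]\<^bsub>T\<^esub> (n - m) = s [^]\<^bsub>T\<^esub> m"
      by (simp only: that(2))
    then have "s [^]\<^bsub>T\<^esub> (n - m) = \<one>\<^bsub>T\<^esub>"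
      using assms(3) by simp
    then show False
      using assms \<open>m \<noteq> n\<close> \<open>m \<le> n\<close> by (auto simp: torsion_free_def)
  qed
  then show ?thesis
    by (metis injI nle_le)
qed

text \<open>Conjugation by a power of \<open>t\<close> translates the finite support of
  \<open>x\<close> by the same power of \<open>snd t\<close>. Since \<open>snd t\<close> has
  infinite order, some power moves this support off that of \<open>y\<close>, and elements of the
  base group with disjoint supports commute.\<close>

lemma wreath_product_eventually_commute:
  assumes F: "group F" and finF: "finite (carrier F)" and T: "group T" and tf: "torsion_free T"
    and x: "x \<in> carrier (wreath_product F T)" "snd x = \<one>\<^bsub>T\<^esub>"
    and y: "y \<in> carrier (wreath_product F T)" "snd y = \<one>\<^bsub>T\<^esub>"
    and t: "t \<in> carrier (wreath_product F T)"
    and inf: "\<And>n::nat. n > 0 \<Longrightarrow> t [^]\<^bsub>wreath_product F T\<^esub> n \<noteq> \<one>\<^bsub>wreath_product F T\<^esub>"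
  obtains n :: nat and u where "u = t [^]\<^bsub>wreath_product F T\<^esub> n"
    "u \<otimes>\<^bsub>wreath_product F T\<^esub> x \<otimes>\<^bsub>wreath_product F T\<^esub> inv\<^bsub>wreath_product F T\<^esub> u \<otimes>\<^bsub>wreath_product F T\<^esub> y
      = y \<otimes>\<^bsub>wreath_product F T\<^esub> (u \<otimes>\<^bsub>wreath_product F T\<^esub> x \<otimes>\<^bsub>wreath_product F T\<^esub> inv\<^bsub>wreath_product F T\<^esub> u)"
proof -
  interpret F: group F by fact
  interpret T: group T by fact
  let ?W = "wreath_product F T"
  interpret W: group ?W using F T by (rule group_wreath_product)
  note car = carrier_wreath_product[OF F]
  interpret snd: group_hom ?W T snd
    by (simp add: group_hom_def group_hom_axioms_def W.is_group T snd_hom_wreath_product[OF F])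
  obtain f g where fg: "x = (f, \<one>\<^bsub>T\<^esub>)" "y = (g, \<one>\<^bsub>T\<^esub>)"
    using x y by (metis prod.collapse)
  define S where "S = {z \<in> carrier T. f z \<noteq> \<one>\<^bsub>F\<^esub>}"
  define S' where "S' = {z \<in> carrier T. g z \<noteq> \<one>\<^bsub>F\<^esub>}"
  have s: "snd t \<in> carrier T" "snd t \<noteq> \<one>\<^bsub>T\<^esub>"
  proof -
    show "snd t \<in> carrier T"
      using t by (auto simp: car)
    show "snd t \<noteq> \<one>\<^bsub>T\<^esub>"
    proof
      assume 1: "snd t = \<one>\<^bsub>T\<^esub>"
      then obtain p where p: "t = (p, \<one>\<^bsub>T\<^esub>)"
        by (metis prod.collapse)
      \<comment> \<open>By Lagrange in each coordinate, every element of the base group is killed by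
        the order of \<open>F\<close>. An element of infinite order therefore has a non-trivial
        component in \<open>T\<close>.\<close>
      have "p z [^]\<^bsub>F\<^esub> order F = \<one>\<^bsub>F\<^esub>" if "z \<in> carrier T" for z
        using t that by (intro F.pow_order_eq_1) (auto simp: p car)
      then have "t [^]\<^bsub>?W\<^esub> order F = \<one>\<^bsub>?W\<^esub>"
        using t by (auto simp: p pow_wreath_product_base[OF F T] one_wreath_product fun_eq_iff)
      then show False
        using inf[of "order F"] F.order_gt_0_iff_finite finF by simp
    qed
  qed
  have fin: "finite S" "finite S'"
    using x y by (auto simp: fg car S_def S'_def)
  \<comment> \<open>The shifts to avoid: a translate of \<open>S\<close> by \<open>r\<close> meets
    \<open>S'\<close> only if \<open>r\<close> carries some \<open>a\<close> in \<open>S\<close> to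
    some \<open>b\<close> in \<open>S'\<close>, that is, if \<open>r\<close> is \<open>b\<close>
    times the inverse of \<open>a\<close>.\<close>
  then have "finite ((\<lambda>(a, b). b \<otimes>\<^bsub>T\<^esub> inv\<^bsub>T\<^esub> a) ` (S \<times> S'))"
    by simp
  moreover have "infinite (range (\<lambda>n::nat. snd t [^]\<^bsub>T\<^esub> n))"
    using torsion_free_inj_pow[OF T tf s] by (simp add: finite_image_iff)
  ultimately obtain n :: nat where n: "snd t [^]\<^bsub>T\<^esub> n \<notin> (\<lambda>(a, b). b \<otimes>\<^bsub>T\<^esub> inv\<^bsub>T\<^esub> a) ` (S \<times> S')"
    by (metis finite_subset image_subsetI)
  define r where "r = snd t [^]\<^bsub>T\<^esub> n"
  have r: "r \<in> carrier T"
    using s by (simp add: r_def)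
  have "snd (t [^]\<^bsub>?W\<^esub> n) = r"
    using t by (simp add: r_def snd.hom_nat_pow)
  then obtain p where p: "t [^]\<^bsub>?W\<^esub> n = (p, r)"
    by (metis prod.collapse)
  have pr: "(p, r) \<in> carrier ?W"
    unfolding p[symmetric] using t by simp
  obtain q where q: "(p, r) \<otimes>\<^bsub>?W\<^esub> (f, \<one>\<^bsub>T\<^esub>) \<otimes>\<^bsub>?W\<^esub> inv\<^bsub>?W\<^esub> (p, r) = (q, \<one>\<^bsub>T\<^esub>)"
    and supp: "\<And>z. z \<in> carrier T \<Longrightarrow> f (inv\<^bsub>T\<^esub> r \<otimes>\<^bsub>T\<^esub> z) = \<one>\<^bsub>F\<^esub> \<Longrightarrow> q z = \<one>\<^bsub>F\<^esub>"
    using wreath_product_conj_base_support[OF F T _ pr] x unfolding fg by metis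
  have "(q, \<one>\<^bsub>T\<^esub>) \<in> carrier ?W"
    unfolding q[symmetric] using pr x by (simp add: fg)
  then have qF: "q z \<in> carrier F" and gF: "g z \<in> carrier F" if "z \<in> carrier T" for z
    using that y by (auto simp: car fg)
  \<comment> \<open>A common point \<open>z\<close> of both supports would come from the point
    \<open>inv r * z\<close> of \<open>S\<close>, and this pair would exhibit \<open>r\<close> as
    one of the excluded shifts.\<close>
  have disj: "q z = \<one>\<^bsub>F\<^esub> \<or> g z = \<one>\<^bsub>F\<^esub>" if z: "z \<in> carrier T" for z
  proof (rule ccontr)
    assume "\<not> ?thesis"
    then have "inv\<^bsub>T\<^esub> r \<otimes>\<^bsub>T\<^esub> z \<in> S" "z \<in> S'"
      using supp z r by (auto simp: S_def S'_def)
    moreover have "z \<otimes>\<^bsub>T\<^esub> inv\<^bsub>T\<^esub> (inv\<^bsub>T\<^esub> r \<otimes>\<^bsub>T\<^esub> z) = r"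
      using z r by (simp add: T.inv_mult_group T.m_assoc[symmetric])
    ultimately show False
      using n by (force simp: r_def)
  qed
  have "q z \<otimes>\<^bsub>F\<^esub> g z = g z \<otimes>\<^bsub>F\<^esub> q z" if "z \<in> carrier T" for z
    using disj[OF that] qF[OF that] gF[OF that] by auto
  then have "(q, \<one>\<^bsub>T\<^esub>) \<otimes>\<^bsub>?W\<^esub> (g, \<one>\<^bsub>T\<^esub>) = (g, \<one>\<^bsub>T\<^esub>) \<otimes>\<^bsub>?W\<^esub> (q, \<one>\<^bsub>T\<^esub>)"
    by (auto simp: mult_wreath_product fun_eq_iff)
  then show ?thesis
    using that[OF refl, of n] by (simp add: p fg q)
qed

text \<open>The power with exponent \<open>order G\<close> is trivial in \<open>G\<close>, hence
  also on images. This is what places the copy of \<open>G\<close> inside the base group.\<close>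

lemma hom_finite_torsion_free_trivial:
  assumes "group G" "finite (carrier G)" "group T" "torsion_free T" "f \<in> hom G T" "x \<in> carrier G"
  shows "f x = \<one>\<^bsub>T\<^esub>"
proof -
  interpret group_hom G T f
    using assms(1,3,5) by (simp add: group_hom_def group_hom_axioms_def)
  have "f x [^]\<^bsub>T\<^esub> order G = \<one>\<^bsub>T\<^esub>"
    using hom_nat_pow[OF assms(6), of "order G"] G.pow_order_eq_1[OF assms(6)] by simp
  moreover have "order G > 0"
    using assms(2) G.order_gt_0_iff_finite by simp
  moreover have "f x \<in> carrier T"
    using assms(6) by simp
  ultimately show ?thesis
    using assms(4) unfolding torsion_free_def by blast
qed

section \<open>The automata group of a Cayley machine\<close>

text \<open>The restriction to words over the carrier makes the map extensional, as membership in
  \<open>BijGroup\<close> demands.\<close>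

definition left_translation :: "('a, 'm) monoid_scheme \<Rightarrow> 'a \<Rightarrow> (nat \<Rightarrow> 'a) \<Rightarrow> (nat \<Rightarrow> 'a)" where
  "left_translation G g = (\<lambda>a\<in>omega_words (carrier G). \<lambda>n. g \<otimes>\<^bsub>G\<^esub> a n)"

section \<open>Pointwise computation in the group of bijections of a set\<close>

lemma mult_BijGroup_apply:
  assumes "f \<in> carrier (BijGroup S)" "g \<in> carrier (BijGroup S)" "a \<in> S"
  shows "(f \<otimes>\<^bsub>BijGroup S\<^esub> g) a = f (g a)"
  using assms by (simp add: BijGroup_def compose_def)

lemma one_BijGroup_apply:
  assumes "a \<in> S"
  shows "\<one>\<^bsub>BijGroup S\<^esub> a = a"
  using assms by (simp add: BijGroup_def)

lemma BijGroup_closed: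
  assumes "f \<in> carrier (BijGroup S)" "a \<in> S"
  shows "f a \<in> S"
  using assms by (auto simp: BijGroup_def Bij_def bij_betw_def)

lemma BijGroup_eqI:
  assumes "f \<in> carrier (BijGroup S)" "g \<in> carrier (BijGroup S)" "\<And>a. a \<in> S \<Longrightarrow> f a = g a"
  shows "f = g"
  using assms by (auto simp: BijGroup_def Bij_def intro: extensionalityI)

context group
begin

section \<open>Left translations and the letter recursion of state maps\<close>

lemma left_translation_Bij:
  assumes g: "g \<in> carrier G"
  shows "left_translation G g \<in> carrier (BijGroup (omega_words (carrier G)))"
proof -
  let ?W = "omega_words (carrier G)"
  have "bij_betw (left_translation G g) ?W ?W"
    by (rule bij_betw_byWitness[where f' = "left_translation G (inv g)"])
      (use g in \<open>auto simp: left_translation_def omega_words_def m_assoc[symmetric]\<close>)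
  then show ?thesis
    by (simp add: BijGroup_def Bij_def left_translation_def)
qed

lemma left_translation_hom:
  "left_translation G \<in> hom G (BijGroup (omega_words (carrier G)))"
proof (rule homI)
  interpret B: group "BijGroup (omega_words (carrier G))" by (rule group_BijGroup)
  fix g h assume gh: "g \<in> carrier G" "h \<in> carrier G"
  show "left_translation G (g \<otimes> h) =
      left_translation G g \<otimes>\<^bsub>BijGroup (omega_words (carrier G))\<^esub> left_translation G h"
  proof (rule BijGroup_eqI)
    fix a assume "a \<in> omega_words (carrier G)"
    then show "left_translation G (g \<otimes> h) a =
        (left_translation G g \<otimes>\<^bsub>BijGroup (omega_words (carrier G))\<^esub> left_translation G h) a"
      using gh by (simp add: mult_BijGroup_apply left_translation_Bij)
        (auto simp: left_translation_def omega_words_def m_assoc)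
  qed (use gh left_translation_Bij in auto)
qed (rule left_translation_Bij)

lemma cayley_map_0:
  assumes "a \<in> omega_words (carrier G)"
  shows "mealy_map (cayley_machine G) g a 0 = g \<otimes> a 0"
  using assms by (simp add: cayley_map_apply)

lemma cayley_map_Suc:
  assumes "a \<in> omega_words (carrier G)"
  shows "mealy_map (cayley_machine G) g a (Suc n) = mealy_map (cayley_machine G) g a n \<otimes> a (Suc n)"
  using assms by (simp add: cayley_map_apply)

text \<open>Output letters are running products of the input, started at the state; by associativity
  the starting factor \<open>g\<close> can be pulled out in front of every letter. Solving for the
  translation shows that it belongs to the automata group.\<close>

lemma cayley_map_eq_left_translation:
  assumes g: "g \<in> carrier G"
  shows "mealy_map (cayley_machine G) g =
    left_translation G g \<otimes>\<^bsub>BijGroup (omega_words (carrier G))\<^esub> mealy_map (cayley_machine G) \<one>"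
proof (rule BijGroup_eqI)
  interpret B: group "BijGroup (omega_words (carrier G))" by (rule group_BijGroup)
  let ?t = "mealy_map (cayley_machine G) \<one>"
  show "left_translation G g \<otimes>\<^bsub>BijGroup (omega_words (carrier G))\<^esub> ?t
      \<in> carrier (BijGroup (omega_words (carrier G)))"
    using g by (simp add: left_translation_Bij cayley_map_Bij)
  fix a assume a: "a \<in> omega_words (carrier G)"
  have t: "?t a \<in> omega_words (carrier G)"
    using BijGroup_closed[OF cayley_map_Bij a] by simp
  have "mealy_map (cayley_machine G) g a n = g \<otimes> ?t a n" for n
  proof (induction n)
    case 0
    then show ?case using a g by (simp add: cayley_map_0 omega_words_def)
  next
    case (Suc n)
    then show ?case
      using a g t by (simp add: cayley_map_Suc omega_words_def m_assoc)
  qed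
  then show "mealy_map (cayley_machine G) g a =
      (left_translation G g \<otimes>\<^bsub>BijGroup (omega_words (carrier G))\<^esub> ?t) a"
    using a g t by (simp add: mult_BijGroup_apply left_translation_Bij cayley_map_Bij)
      (simp add: left_translation_def fun_eq_iff)
qed (rule cayley_map_Bij[OF g])

text \<open>Each input letter after the first is the quotient of two consecutive output letters.
  Beyond position \<open>Suc k\<close> both of these are trivial; at \<open>Suc k\<close> only the
  later one is, so a non-trivial letter remains there.\<close>

lemma cayley_map_one_last_letter:
  assumes a: "a \<in> omega_words (carrier G)"
    and k: "mealy_map (cayley_machine G) \<one> a k \<noteq> \<one>"
    and gt: "\<And>j. j > k \<Longrightarrow> mealy_map (cayley_machine G) \<one> a j = \<one>"
  shows "a (Suc k) \<noteq> \<one> \<and> (\<forall>j > Suc k. a j = \<one>)"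
proof -
  let ?t = "mealy_map (cayley_machine G) \<one>"
  have aC: "a n \<in> carrier G" and tC: "?t a n \<in> carrier G" for n
    using a BijGroup_closed[OF cayley_map_Bij a, of \<one>] by (auto simp: omega_words_def)
  have "a j = \<one>" if j: "j > Suc k" for j
  proof -
    obtain i where i: "j = Suc i" "i > k"
      using j by (auto simp: Suc_less_eq2)
    have "a j = ?t a i \<otimes> a j"
      using gt[OF i(2)] aC by simp
    also have "\<dots> = ?t a j"
      by (simp only: i(1) cayley_map_Suc[OF a])
    also have "\<dots> = \<one>"
      using gt j by simp
    finally show ?thesis .
  qed
  moreover have "a (Suc k) \<noteq> \<one>"
  proof
    assume "a (Suc k) = \<one>"
    then have "?t a (Suc k) = ?t a k"
      using cayley_map_Suc[OF a, of \<one> k] tC by simp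
    then show False
      using gt[of "Suc k"] k by simp
  qed
  ultimately show ?thesis
    by blast
qed

lemma cayley_map_one_infinite_order:
  assumes "x \<in> carrier G" "x \<noteq> \<one>" "n > 0"
  shows "mealy_map (cayley_machine G) \<one> [^]\<^bsub>BijGroup (omega_words (carrier G))\<^esub> (n::nat)
    \<noteq> \<one>\<^bsub>BijGroup (omega_words (carrier G))\<^esub>"
proof
  let ?S = "omega_words (carrier G)"
  let ?t = "mealy_map (cayley_machine G) \<one>"
  interpret B: group "BijGroup ?S" by (rule group_BijGroup)
  have t: "?t \<in> carrier (BijGroup ?S)"
    by (simp add: cayley_map_Bij)
  \<comment> \<open>The output \<open>b\<close> stays fixed while \<open>a\<close> varies: the power
    with exponent \<open>Suc n\<close> applies the state map first, so the induction hypothesis is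
    used for the word \<open>?t a\<close>. Each step backwards moves the last non-trivial letter one
    place to the right.\<close>
  have last: "a (n + k) \<noteq> \<one> \<and> (\<forall>j > n + k. a j = \<one>)"
    if "a \<in> ?S" "b = (?t [^]\<^bsub>BijGroup ?S\<^esub> n) a" "b k \<noteq> \<one>" "\<forall>j > k. b j = \<one>" for a b k n
    using that
  proof (induction n arbitrary: a)
    case 0
    then show ?case by (simp add: one_BijGroup_apply)
  next
    case (Suc n)
    have ta: "?t a \<in> ?S"
      using BijGroup_closed[OF t] Suc.prems by blast
    have "b = (?t [^]\<^bsub>BijGroup ?S\<^esub> n) (?t a)"
      using Suc.prems t by (simp add: mult_BijGroup_apply)
    then have "?t a (n + k) \<noteq> \<one> \<and> (\<forall>j > n + k. ?t a j = \<one>)"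
      using Suc.IH[OF ta] Suc.prems by blast
    then show ?case
      using cayley_map_one_last_letter[OF Suc.prems(1), of "n + k"] by simp
  qed
  assume eq: "?t [^]\<^bsub>BijGroup ?S\<^esub> n = \<one>\<^bsub>BijGroup ?S\<^esub>"
  \<comment> \<open>The last non-trivial letter of this word is at position 0. If the power with
    exponent \<open>n\<close> were the identity, the word would be its own preimage and would have a
    non-trivial letter at position \<open>n > 0\<close> as well.\<close>
  define a where "a j = (if j = 0 then x else \<one>)" for j :: nat
  have a: "a \<in> ?S"
    using assms by (simp add: a_def omega_words_def)
  have "a = (?t [^]\<^bsub>BijGroup ?S\<^esub> n) a"
    using a by (simp add: eq one_BijGroup_apply)
  then have "a (n + 0) \<noteq> \<one>"
    using last[OF a, of a n 0] assms by (simp add: a_def)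
  then show False
    using assms by (simp add: a_def)
qed

text \<open>Only first letters matter. The power \<open>u\<close> and its inverse fix them, so the
  conjugate of the translation by \<open>g\<close> still multiplies the first letter by
  \<open>g\<close>, and the two products differ there.\<close>

lemma cayley_map_one_conj_not_commute:
  fixes n :: nat
  assumes g: "g \<in> carrier G" and h: "h \<in> carrier G" and ne: "g \<otimes> h \<noteq> h \<otimes> g"
    and u: "u = mealy_map (cayley_machine G) \<one> [^]\<^bsub>BijGroup (omega_words (carrier G))\<^esub> n"
    and B: "B = BijGroup (omega_words (carrier G))"
  shows "u \<otimes>\<^bsub>B\<^esub> left_translation G g \<otimes>\<^bsub>B\<^esub> inv\<^bsub>B\<^esub> u \<otimes>\<^bsub>B\<^esub> left_translation G h \<noteq>
    left_translation G h \<otimes>\<^bsub>B\<^esub> (u \<otimes>\<^bsub>B\<^esub> left_translation G g \<otimes>\<^bsub>B\<^esub> inv\<^bsub>B\<^esub> u)"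
proof
  let ?S = "omega_words (carrier G)"
  let ?t = "mealy_map (cayley_machine G) \<one>"
  interpret B: group B unfolding B by (rule group_BijGroup)
  note app = mult_BijGroup_apply[of _ ?S, folded B]
  note app1 = one_BijGroup_apply[of _ ?S, folded B]
  note cl = BijGroup_closed[of _ ?S, folded B]
  have t: "?t \<in> carrier B" and l: "left_translation G g \<in> carrier B" "left_translation G h \<in> carrier B"
    using g h by (simp_all add: B cayley_map_Bij left_translation_Bij)
  then have uB: "u \<in> carrier B"
    by (simp add: u flip: B)
  have l0: "left_translation G k a 0 = k \<otimes> a 0" if "a \<in> ?S" for k a
    using that by (simp add: left_translation_def)
  have u0: "u a 0 = a 0" if "a \<in> ?S" for a
    unfolding u B[symmetric] using that
  proof (induction n arbitrary: a)
    case 0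
    then show ?case by (simp add: app1)
  next
    case (Suc n)
    have "?t a \<in> ?S"
      using cl[OF t] Suc.prems by blast
    moreover have "?t a 0 = a 0"
      using Suc.prems by (simp add: cayley_map_0 omega_words_def)
    ultimately show ?case
      using Suc t by (simp add: app)
  qed
  \<comment> \<open>The first letter of \<open>inv u\<close> at \<open>a\<close> equals that of its
    image under \<open>u\<close>, which is \<open>a\<close> itself.\<close>
  have v0: "(inv\<^bsub>B\<^esub> u) a 0 = a 0" if a: "a \<in> ?S" for a
  proof -
    have "u ((inv\<^bsub>B\<^esub> u) a) = (u \<otimes>\<^bsub>B\<^esub> inv\<^bsub>B\<^esub> u) a"
      using a uB by (subst app) auto
    also have "\<dots> = a"
      using a uB by (simp add: app1)
    finally show ?thesis
      using u0[of "(inv\<^bsub>B\<^esub> u) a"] cl[of "inv\<^bsub>B\<^esub> u" a] a uB by simp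
  qed
  assume eq: "u \<otimes>\<^bsub>B\<^esub> left_translation G g \<otimes>\<^bsub>B\<^esub> inv\<^bsub>B\<^esub> u \<otimes>\<^bsub>B\<^esub> left_translation G h =
    left_translation G h \<otimes>\<^bsub>B\<^esub> (u \<otimes>\<^bsub>B\<^esub> left_translation G g \<otimes>\<^bsub>B\<^esub> inv\<^bsub>B\<^esub> u)"
  \<comment> \<open>On the constant word of identities the first letters of the two sides are
    exactly \<open>g * h\<close> and \<open>h * g\<close>.\<close>
  define a where "a = (\<lambda>j::nat. \<one>)"
  have a: "a \<in> ?S"
    by (simp add: a_def omega_words_def)
  have "g \<otimes> h = (u \<otimes>\<^bsub>B\<^esub> left_translation G g \<otimes>\<^bsub>B\<^esub> inv\<^bsub>B\<^esub> u \<otimes>\<^bsub>B\<^esub> left_translation G h) a 0"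
    using a uB l g h by (simp add: app cl u0 v0 l0) (simp add: a_def)
  also have "\<dots> = h \<otimes> g"
    unfolding eq using a uB l g h by (simp add: app cl u0 v0 l0) (simp add: a_def)
  finally show False
    using ne by simp
qed

end

theorem theorem1p2:
  fixes G :: "('a, 'm) monoid_scheme"
    and F :: "('f, 'k) monoid_scheme"
    and T :: "('t, 'l) monoid_scheme"
  assumes "group G" and "finite (carrier G)" and "\<not> comm_group G"
    and "\<exists>H. subgroup H G \<and> finite_p_group 2 (G\<lparr>carrier := H\<rparr>)
             \<and> has_nilpotency_class (G\<lparr>carrier := H\<rparr>) 2"
    and "group F" and "finite (carrier F)"
    and "group T" and "torsion_free T"
  shows "\<not> embeds_in (automata_group (cayley_machine G)) (wreath_product F T)"
proof
  let ?W = "wreath_product F T"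
  let ?L = "left_translation G"
  interpret G: group G by fact
  interpret W: group ?W by (rule group_wreath_product) fact+
  define B where "B = BijGroup (omega_words (carrier G))"
  interpret B: group B unfolding B_def by (rule group_BijGroup)
  define t where "t = mealy_map (cayley_machine G) \<one>\<^bsub>G\<^esub>"
  define A where "A = automata_group (cayley_machine G)"
  have A: "A = subgroup_generated B (mealy_map (cayley_machine G) ` carrier G)"
    by (simp add: A_def automata_group_def B_def cayley_machine_def)
  interpret A: group A unfolding A by simp
  assume "embeds_in (automata_group (cayley_machine G)) ?W"
  then obtain e where e: "e \<in> hom A ?W" "inj_on e (carrier A)"
    by (auto simp: embeds_in_def mon_def A_def)
  interpret e: group_hom A ?W e
    using e by (simp add: group_hom_def group_hom_axioms_def A.is_group W.is_group)
  have AB: "carrier A \<subseteq> carrier B" and mult: "(\<otimes>\<^bsub>A\<^esub>) = (\<otimes>\<^bsub>B\<^esub>)" and one: "\<one>\<^bsub>A\<^esub> = \<one>\<^bsub>B\<^esub>"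
    by (simp_all add: A B.carrier_subgroup_generated_subset)
  have invA: "inv\<^bsub>A\<^esub> z = inv\<^bsub>B\<^esub> z" if "z \<in> carrier A" for z
    using that by (simp add: A B.inv_subgroup_generated)
  have powA: "z [^]\<^bsub>A\<^esub> (n::nat) = z [^]\<^bsub>B\<^esub> n" for z n
    by (simp add: A pow_subgroup_generated)
  \<comment> \<open>Since \<open>subgroup_generated\<close> keeps only generators from the carrier,
    bijectivity of the state maps is needed here.\<close>
  have gen: "mealy_map (cayley_machine G) g \<in> carrier A" if "g \<in> carrier G" for g
    using that G.cayley_map_Bij by (auto simp: A carrier_subgroup_generated B_def intro: generate.incl)
  then have t: "t \<in> carrier A"
    by (simp add: t_def)
  have L: "?L g \<in> carrier A" if "g \<in> carrier G" for g
  proof -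
    have "?L g \<in> carrier B"
      using that by (simp add: B_def G.left_translation_Bij)
    \<comment> \<open>The factorization of the state map of \<open>g\<close>, solved for the
      translation.\<close>
    then have "?L g = mealy_map (cayley_machine G) g \<otimes>\<^bsub>A\<^esub> inv\<^bsub>A\<^esub> t"
      using G.cayley_map_eq_left_translation[OF that] t AB
      by (auto simp: mult invA B.m_assoc simp flip: B_def t_def)
    then show ?thesis
      using gen[OF that] t by simp
  qed
  have L_hom: "?L \<in> hom G A"
    using G.left_translation_hom L by (auto simp: hom_def mult simp flip: B_def)
  have base: "snd (e (?L g)) = \<one>\<^bsub>T\<^esub>" if "g \<in> carrier G" for g
  proof -
    \<comment> \<open>The composite from \<open>G\<close> through the automata group and the wreath
      product to \<open>T\<close> maps a finite group to a torsion-free one, so it is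
      trivial.\<close>
    have "snd \<circ> (e \<circ> ?L) \<in> hom G T"
      using hom_compose[OF hom_compose[OF L_hom e(1)] snd_hom_wreath_product] assms by blast
    from hom_finite_torsion_free_trivial[OF _ _ _ _ this that] show ?thesis
      using assms by simp
  qed
  obtain g h where gh: "g \<in> carrier G" "h \<in> carrier G" "g \<otimes>\<^bsub>G\<^esub> h \<noteq> h \<otimes>\<^bsub>G\<^esub> g"
    using \<open>\<not> comm_group G\<close> G.group_comm_groupI by blast
  \<comment> \<open>A non-trivial letter is what the infinite order of \<open>t\<close> rests on; a
    non-commuting pair provides one.\<close>
  then have "g \<noteq> \<one>\<^bsub>G\<^esub>"
    by auto
  have inf: "e t [^]\<^bsub>?W\<^esub> n \<noteq> \<one>\<^bsub>?W\<^esub>" if "n > 0" for n :: nat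
  proof
    assume "e t [^]\<^bsub>?W\<^esub> n = \<one>\<^bsub>?W\<^esub>"
    then have "e (t [^]\<^bsub>A\<^esub> n) = e \<one>\<^bsub>A\<^esub>"
      using t by (simp add: e.hom_nat_pow)
    then have "t [^]\<^bsub>A\<^esub> n = \<one>\<^bsub>A\<^esub>"
      by (rule inj_onD[OF e(2)]) (use t in auto)
    then show False
      using G.cayley_map_one_infinite_order[OF gh(1) \<open>g \<noteq> \<one>\<^bsub>G\<^esub>\<close> that]
      by (simp add: powA one t_def B_def)
  qed
  obtain n v where v: "v = e t [^]\<^bsub>?W\<^esub> (n::nat)"
    and comm: "v \<otimes>\<^bsub>?W\<^esub> e (?L g) \<otimes>\<^bsub>?W\<^esub> inv\<^bsub>?W\<^esub> v \<otimes>\<^bsub>?W\<^esub> e (?L h)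
      = e (?L h) \<otimes>\<^bsub>?W\<^esub> (v \<otimes>\<^bsub>?W\<^esub> e (?L g) \<otimes>\<^bsub>?W\<^esub> inv\<^bsub>?W\<^esub> v)"
    by (rule wreath_product_eventually_commute[of F T "e (?L g)" "e (?L h)" "e t"])
      (use assms L gh t base inf in auto)
  \<comment> \<open>As \<open>v\<close> is the image of a power of \<open>t\<close>, the commutation
    found in the wreath product pulls back along the injective \<open>e\<close> to the automata
    group, where comparing first letters rules it out.\<close>
  define u where "u = t [^]\<^bsub>A\<^esub> n"
  have u: "u \<in> carrier A" "v = e u"
    using t by (simp_all add: u_def v e.hom_nat_pow)
  have "e (u \<otimes>\<^bsub>A\<^esub> ?L g \<otimes>\<^bsub>A\<^esub> inv\<^bsub>A\<^esub> u \<otimes>\<^bsub>A\<^esub> ?L h) = e (?L h \<otimes>\<^bsub>A\<^esub> (u \<otimes>\<^bsub>A\<^esub> ?L g \<otimes>\<^bsub>A\<^esub> inv\<^bsub>A\<^esub> u))"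
    using comm u L gh by simp
  then have "u \<otimes>\<^bsub>A\<^esub> ?L g \<otimes>\<^bsub>A\<^esub> inv\<^bsub>A\<^esub> u \<otimes>\<^bsub>A\<^esub> ?L h = ?L h \<otimes>\<^bsub>A\<^esub> (u \<otimes>\<^bsub>A\<^esub> ?L g \<otimes>\<^bsub>A\<^esub> inv\<^bsub>A\<^esub> u)"
    by (rule inj_onD[OF e(2)]) (use u L gh in auto)
  then show False
    using G.cayley_map_one_conj_not_commute[OF gh _ B_def, of u n] u(1)
    by (simp add: mult invA u_def powA t_def B_def)
qed

end
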